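(* With all notation as defined in the context, the minimax risk satisfies $$\mathfrak{M}(T,\mathbb{P},\Sigma_w,\varrho,K_e,K_c)\;\le\;\Phi(T,\mathbb{P},\Sigma_w,\varrho,K_e,K_c).$$
   Context: Let $n,d\ge 1$ be integers, $\varrho>0$, and let $\Sigma_w\in\mathbf{R}^{n\times n}$, $K_e,K_c\in\mathbf{R}^{d\times d}$ be symmetric positive definite matrices. Let $(\Xi,\mathcal{E},\mathbb{P})$ be a probability space and, for $\xi\in\Xi$, let $T_\xi\in\mathbf{R}^{n\times d}$ be a matrix depending measurably on $\xi$ (a random linear operator $\mathbf{R}^d\to\mathbf{R}^n$). $\mathcal{P}(\Sigma_w)$ is the set of Borel regular conditional probabilities $\nu(\cdot\mid\xi)$ on $\mathbf{R}^n$ such that for $\mathbb{P}$-almost every $\xi$: (i) $\int w\,\nu(dw\mid\xi)=0$; (ii) $\int (u^{\mathsf T}w)^2\,\nu(dw\mid\xi)\le u^{\mathsf T}\Sigma_w u$ for every fixed $u\in\mathbf{R}^n$. Write $(\xi,w)\sim\mathbb{P}\times\nu$ if $\xi\sim\mathbb{P}$ and $w\mid\xi\sim\nu(\cdot\mid\xi)$. The observation is $(T_\xi,y)$ with $y=T_\xi\theta^\star+w$. Norms: $\|\theta\|_{K_e}^2=\langle\theta,K_e\theta\rangle$, $\|\theta\|_{K_c^{-1}}^2=\langle\theta,K_c^{-1}\theta\rangle$; parameter set $\Theta(\varrho,K_c)=\{\theta\in\mathbf{R}^d:\|\theta\|_{K_c^{-1}}\le\varrho\}$. Minimax risk: $$\mathfrak{M}(T,\mathbb{P},\Sigma_w,\varrho,K_e,K_c)=\inf_{\hat\theta}\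 \sup_{\theta^\star\in\Theta(\varrho,K_c),\ \nu\in\mathcal{P}(\Sigma_w)}\ \mathbf{E}_{(\xi,w)\sim\mathbb{P}\times\nu}\big[\|\hat\theta-\theta^\star\|_{K_e}^2\big],$$ the infimum being over all measurable functions $\hat\theta=\hat\theta(T_\xi,y)$ with values in $\mathbf{R}^d$. Functional: $$\Phi(T,\mathbb{P},\Sigma_w,\varrho,K_e,K_c)=\sup_{\Omega}\Big\{\mathbf{E}\,\mathrm{Tr}\big(K_e^{1/2}(\Omega^{-1}+T_\xi^{\mathsf T}\Sigma_w^{-1}T_\xi)^{-1}K_e^{1/2}\big):\ \Omega\succ0,\ \mathrm{Tr}(K_c^{-1/2}\Omega K_c^{-1/2})\le\varrho^2\Big\},$$ where $\Omega$ ranges over symmetric $d\times d$ matrices and the expectation is over $\xi\sim\mathbb{P}$. *)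

theory Defs
  imports "HOL-Probability.Probability"
begin

definition pos_def :: "real^'k^'k \<Rightarrow> bool" where
  "pos_def A \<longleftrightarrow> transpose A = A \<and> (\<forall>x. x \<noteq> 0 \<longrightarrow> 0 < x \<bullet> (A *v x))"

text \<open>The square root of a symmetric positive definite matrix.\<close>

definition mat_sqrt :: "real^'k^'k \<Rightarrow> real^'k^'k" where
  "mat_sqrt A = (THE B. pos_def B \<and> B ** B = A)"

definition wnorm :: "real^'k^'k \<Rightarrow> real^'k \<Rightarrow> real" where
  "wnorm K \<theta> = sqrt (\<theta> \<bullet> (K *v \<theta>))"

definition param_set :: "real \<Rightarrow> real^'d^'d \<Rightarrow> (real^'d) set" where
  "param_set \<rho> Kc = {\<theta>. wnorm (matrix_inv Kc) \<theta> \<le> \<rho>}"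

text \<open>
  The noise class. The second moments are taken as nonnegative integrals, since the Bochner
  integral of a non-integrable function is \<open>0\<close> and the bound would then hold trivially.
\<close>

definition noise_class ::
    "'x measure \<Rightarrow> real^'n^'n \<Rightarrow> ('x \<Rightarrow> (real^'n) measure) set" where
  "noise_class P \<Sigma>w = {\<nu>. \<nu> \<in> P \<rightarrow>\<^sub>M prob_algebra borel \<and>
     (AE \<xi> in P.
        integrable (\<nu> \<xi>) (\<lambda>w. w) \<and> (\<integral>w. w \<partial>\<nu> \<xi>) = 0 \<and>
        (\<forall>u. (\<integral>\<^sup>+w. ennreal ((u \<bullet> w)\<^sup>2) \<partial>\<nu> \<xi>) \<le> ennreal (u \<bullet> (\<Sigma>w *v u))))}"

text \<open>The joint law of \<open>(\<xi>, w)\<close>, where \<open>\<xi>\<close> has law \<open>P\<close> and \<open>w\<close> given \<open>\<xi>\<close> has law \<open>\<nu> \<xi>\<close>.\<close>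

definition joint_law ::
    "'x measure \<Rightarrow> ('x \<Rightarrow> (real^'n) measure) \<Rightarrow> ('x \<times> (real^'n)) measure" where
  "joint_law P \<nu> = P \<bind> (\<lambda>\<xi>. \<nu> \<xi> \<bind> (\<lambda>w. return (P \<Otimes>\<^sub>M borel) (\<xi>, w)))"

text \<open>
  Risks are \<open>ennreal\<close>-valued, so that infinite risk is allowed and the infimum and the
  suprema below are taken in a complete lattice.
\<close>

definition risk ::
    "('x \<Rightarrow> real^'d^'n) \<Rightarrow> 'x measure \<Rightarrow> real^'d^'d \<Rightarrow>
     ((real^'d^'n) \<times> (real^'n) \<Rightarrow> real^'d) \<Rightarrow> real^'d \<Rightarrow> ('x \<Rightarrow> (real^'n) measure) \<Rightarrow> ennreal" where
  "risk T P Ke est \<theta> \<nu> =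
     (\<integral>\<^sup>+(\<xi>, w). ennreal ((wnorm Ke (est (T \<xi>, T \<xi> *v \<theta> + w) - \<theta>))\<^sup>2) \<partial>joint_law P \<nu>)"

definition minimax_risk ::
    "('x \<Rightarrow> real^'d^'n) \<Rightarrow> 'x measure \<Rightarrow> real^'n^'n \<Rightarrow> real \<Rightarrow> real^'d^'d \<Rightarrow> real^'d^'d \<Rightarrow> ennreal" where
  "minimax_risk T P \<Sigma>w \<rho> Ke Kc =
     (INF est \<in> borel_measurable borel.
        SUP (\<theta>, \<nu>) \<in> param_set \<rho> Kc \<times> noise_class P \<Sigma>w. risk T P Ke est \<theta> \<nu>)"

text \<open>
  The trace below is that of a positive definite matrix, so \<open>ennreal\<close> does not truncate it.
\<close>

definition functional_Phi ::
    "('x \<Rightarrow> real^'d^'n) \<Rightarrow> 'x measure \<Rightarrow> real^'n^'n \<Rightarrow> real \<Rightarrow> real^'d^'d \<Rightarrow> real^'d^'d \<Rightarrow> ennreal" where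
  "functional_Phi T P \<Sigma>w \<rho> Ke Kc =
     (SUP \<Omega> \<in> {\<Omega>. pos_def \<Omega> \<and>
          trace (matrix_inv (mat_sqrt Kc) ** \<Omega> ** matrix_inv (mat_sqrt Kc)) \<le> \<rho>\<^sup>2}.
        \<integral>\<^sup>+\<xi>. ennreal (trace (mat_sqrt Ke **
            matrix_inv (matrix_inv \<Omega> + transpose (T \<xi>) ** matrix_inv \<Sigma>w ** T \<xi>) **
            mat_sqrt Ke)) \<partial>P)"

end

theory Submission
  imports Defs
begin

text \<open>A single linear estimator achieves the bound, and its existence is a saddle point property. If \<open>\<theta>\<close> is
  random with second moment matrix \<open>M\<close> and the estimator is the best linear one for the prior
  covariance \<open>\<Omega>\<close>, the mean squared error is at most a quantity \<open>R M \<Omega>\<close> (\<open>mean_risk\<close>). For a fixed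
  \<open>\<theta>\<close> and any noise law of the class this holds with \<open>M = \<theta> \<theta>\<^sup>T\<close>
  (\<open>risk_linear_estimator_le\<close>), because the noise is centred and enters only through its second
  moments. The diagonal \<open>R \<Omega> \<Omega>\<close> is the Bayes risk, that is, the objective of \<open>\<Phi>\<close>
  (\<open>mean_risk_self\<close>).

  Two properties of \<open>R\<close> are decisive: it is affine in \<open>M\<close>, and \<open>R M \<Omega> \<ge> R M M\<close> because the best
  linear estimator for \<open>M\<close> is tuned to \<open>M\<close>. They make the Bayes risk concave with \<open>R M \<Omega> - R \<Omega> \<Omega>\<close>
  as its slope from \<open>\<Omega>\<close> towards \<open>M\<close>. At a maximiser \<open>\<Omega>\<close> the slope towards each \<open>\<theta> \<theta>\<^sup>T\<close> with \<open>\<theta>\<close> in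
  the ellipsoid, which satisfies the trace constraint, is not positive. So the estimator tuned to
  \<open>\<Omega>\<close> has risk at most \<open>R \<Omega> \<Omega> = \<Phi>\<close> for all \<open>\<theta>\<close> in the ellipsoid and all noise laws of
  the class.

  A maximiser need not exist among the positive definite matrices. The slope argument is therefore
  carried out for near-maximisers, with an explicit error (\<open>mean_risk_near_maximiser\<close>), and a
  limit is taken: near-maximisers have a convergent subsequence
  (\<open>admissible_convergent_subseq\<close>), the estimator depends continuously on \<open>\<Omega>\<close> up to the singular
  boundary (\<open>tendsto_gain\<close>), and Fatou's lemma preserves upper bounds on the risk
  (\<open>mean_risk_le_liminf\<close>). The result is \<open>least_favourable_covariance\<close>.\<close>

section \<open>Quadratic forms of symmetric matrices\<close>

definition quad :: "real^'k^'k \<Rightarrow> real^'k \<Rightarrow> real" where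
  "quad M x = x \<bullet> (M *v x)"

definition pos_semidef :: "real^'k^'k \<Rightarrow> bool" where
  "pos_semidef A \<longleftrightarrow> transpose A = A \<and> (\<forall>x. 0 \<le> quad A x)"

lemma pos_semidef_quad: "pos_semidef A \<Longrightarrow> 0 \<le> quad A x"
  by (simp add: pos_semidef_def)

lemma pos_def_imp_pos_semidef: "pos_def A \<Longrightarrow> pos_semidef A"
  unfolding pos_def_def pos_semidef_def quad_def
  by (metis inner_zero_left order.refl order.strict_implies_order)

lemma pos_def_quad_pos: "pos_def A \<Longrightarrow> x \<noteq> 0 \<Longrightarrow> 0 < quad A x"
  by (simp add: pos_def_def quad_def)

lemma inner_symmetric:
  fixes A :: "real^'k^'k"
  assumes "transpose A = A"
  shows "(A *v x) \<bullet> y = x \<bullet> (A *v y)"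
  by (metis assms dot_lmul_matrix transpose_matrix_vector)

lemma transpose_add: "transpose (A + B) = transpose A + transpose B"
  by (vector transpose_def)

lemma quad_add: "quad (A + B) x = quad A x + quad B x"
  by (simp add: quad_def algebra_simps inner_add_right)

lemma quad_scaleR: "quad (c *\<^sub>R A) x = c * quad A x"
  by (simp add: quad_def flip: scaleR_matrix_vector_assoc)

lemma quad_vector_add:
  assumes "transpose A = A"
  shows "quad A (x + y) = quad A x + 2 * (x \<bullet> (A *v y)) + quad A y"
  using inner_symmetric[OF assms, of x y]
  by (simp add: quad_def algebra_simps inner_add_right inner_add_left inner_commute)

lemma quad_vector_scaleR: "quad A (c *\<^sub>R x) = c\<^sup>2 * quad A x"
  by (simp add: quad_def matrix_vector_mult_scaleR power2_eq_square)

lemma quad_congruence: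
  fixes C :: "real^'m^'k"
  shows "quad (C ** A ** transpose C) x = quad A (x v* C)"
  by (simp add: quad_def dot_lmul_matrix flip: matrix_vector_mul_assoc)

lemma pos_semidef_congruence:
  fixes C :: "real^'m^'k"
  shows "pos_semidef A \<Longrightarrow> pos_semidef (C ** A ** transpose C)"
  by (simp add: pos_semidef_def quad_congruence matrix_transpose_mul matrix_mul_assoc)

lemma pos_def_add_pos_semidef:
  "pos_semidef A \<Longrightarrow> pos_def B \<Longrightarrow> pos_def (A + B)"
  using pos_def_quad_pos[of B]
  by (auto simp: pos_def_def pos_semidef_def transpose_add quad_add simp flip: quad_def
      intro: add_nonneg_pos)

lemma pos_semidef_scaleR: "0 \<le> c \<Longrightarrow> pos_semidef A \<Longrightarrow> pos_semidef (c *\<^sub>R A)"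
  by (simp add: pos_semidef_def transpose_scalar quad_scaleR)

lemma pos_def_scaleR: "0 < c \<Longrightarrow> pos_def A \<Longrightarrow> pos_def (c *\<^sub>R A)"
  by (simp add: pos_def_def transpose_scalar quad_scaleR flip: quad_def)

lemma pos_def_mat_1: "pos_def (mat 1)"
  by (simp add: pos_def_def)

lemma pos_def_invertible:
  assumes "pos_def A"
  shows "invertible A"
proof -
  have "\<forall>x. A *v x = 0 \<longrightarrow> x = 0"
    using assms unfolding pos_def_def by (metis inner_zero_right less_irrefl)
  then show ?thesis
    by (simp add: invertible_left_inverse matrix_left_invertible_ker)
qed

lemma matrix_inv_cancel:
  assumes "invertible A"
  shows "A ** matrix_inv A = mat 1" "matrix_inv A ** A = mat 1"
proof -
  have "A ** matrix_inv A = mat 1 \<and> matrix_inv A ** A = mat 1"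
    using someI_ex[OF assms[unfolded invertible_def]] unfolding matrix_inv_def by simp
  then show "A ** matrix_inv A = mat 1" "matrix_inv A ** A = mat 1" by auto
qed

lemma matrix_inv_vector_cancel:
  assumes "invertible A"
  shows "A *v (matrix_inv A *v x) = x" "matrix_inv A *v (A *v x) = x"
  using matrix_inv_cancel[OF assms] by (simp_all add: matrix_vector_mul_assoc)

lemma matrix_inv_unique:
  fixes A :: "real^'k^'k"
  assumes "A ** B = mat 1"
  shows "matrix_inv A = B"
proof -
  have "invertible A"
    using assms by (auto simp: invertible_right_inverse)
  then show ?thesis
    by (metis assms matrix_inv_cancel(2) matrix_mul_assoc matrix_mul_lid matrix_mul_rid)
qed

lemma pos_def_matrix_inv:
  assumes "pos_def A"
  shows "pos_def (matrix_inv A)"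
proof -
  note inv = pos_def_invertible[OF assms]
  have sym: "transpose A = A" using assms by (simp add: pos_def_def)
  have "A ** transpose (matrix_inv A) = mat 1"
    by (metis inv matrix_inv_cancel(2) matrix_transpose_mul sym transpose_mat)
  then have "transpose (matrix_inv A) = matrix_inv A"
    by (metis matrix_inv_unique)
  moreover have "0 < x \<bullet> (matrix_inv A *v x)" if "x \<noteq> 0" for x
  proof -
    have "matrix_inv A *v x \<noteq> 0"
      using that matrix_inv_vector_cancel(1)[OF inv, of x] by auto
    then have "0 < quad A (matrix_inv A *v x)"
      by (rule pos_def_quad_pos[OF assms])
    then show ?thesis
      by (simp add: quad_def matrix_inv_vector_cancel[OF inv] inner_commute)
  qed
  ultimately show ?thesis by (simp add: pos_def_def)
qed

text \<open>This turns every trace of the problem into a finite sum of quadratic forms along the columns of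
  \<open>B\<close>. With \<open>B\<close> a square root of \<open>Ke\<close>, the estimation of a vector splits in this way into the
  estimation of the scalars \<open>b \<bullet> \<theta>\<close>, one for each column \<open>b\<close>, and the rest of the argument handles
  vectors rather than rectangular matrices.\<close>

lemma trace_symmetric_sandwich:
  fixes B S :: "real^'k^'k"
  assumes "transpose B = B"
  shows "trace (B ** S ** B) = (\<Sum>i\<in>UNIV. quad S (B *v axis i 1))"
proof -
  have "(B ** S ** B) $ i $ i = quad S (B *v axis i 1)" for i
  proof -
    have "(B ** S ** B) $ i $ i = axis i 1 \<bullet> ((B ** S ** B) *v axis i 1)"
      by (simp add: inner_axis' matrix_vector_mult_basis column_def)
    also have "\<dots> = quad S (B *v axis i 1)"
      by (simp add: quad_def inner_symmetric[OF assms] flip: matrix_vector_mul_assoc)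
    finally show ?thesis .
  qed
  then show ?thesis by (simp add: trace_def)
qed

lemma quad_square_sum:
  fixes B :: "real^'k^'k"
  assumes "transpose B = B"
  shows "quad (B ** B) v = (\<Sum>i\<in>UNIV. ((B *v axis i 1) \<bullet> v)\<^sup>2)"
proof -
  have "quad (B ** B) v = (B *v v) \<bullet> (B *v v)"
    by (simp add: quad_def inner_symmetric[OF assms] flip: matrix_vector_mul_assoc)
  also have "\<dots> = (\<Sum>i\<in>UNIV. (axis i 1 \<bullet> (B *v v))\<^sup>2)"
    by (subst inner_vec_def) (simp add: inner_axis' power2_eq_square)
  finally show ?thesis
    by (simp add: inner_symmetric[OF assms])
qed

lemma norm_matrix_le_entries:
  fixes A :: "real^'m^'k"
  assumes "\<And>i j. \<bar>A $ i $ j\<bar> \<le> c"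
  shows "norm A \<le> real CARD('k) * (real CARD('m) * c)"
proof -
  have row: "norm (A $ i) \<le> real CARD('m) * c" for i
  proof -
    have "norm (A $ i) \<le> (\<Sum>j\<in>UNIV. \<bar>A $ i $ j\<bar>)" by (rule norm_le_l1_cart)
    also have "\<dots> \<le> (\<Sum>j\<in>(UNIV::'m set). c)" by (intro sum_mono assms)
    finally show ?thesis by simp
  qed
  have "norm A \<le> (\<Sum>i\<in>UNIV. norm (A $ i))"
    unfolding norm_vec_def by (rule L2_set_le_sum) simp
  also have "\<dots> \<le> (\<Sum>i\<in>(UNIV::'k set). real CARD('m) * c)" by (intro sum_mono row)
  finally show ?thesis by simp
qed

text \<open>Testing semidefiniteness on \<open>e\<^sub>i \<plusminus> e\<^sub>j\<close> bounds an off-diagonal entry by the mean of two diagonal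
  entries. Hence a bound on the trace confines semidefinite matrices to a bounded set.\<close>

lemma pos_semidef_entry_le_trace:
  assumes "pos_semidef A"
  shows "\<bar>A $ i $ j\<bar> \<le> trace A"
proof -
  have sym: "transpose A = A" using assms by (simp add: pos_semidef_def)
  have diag: "quad A (axis k 1) = A $ k $ k" for k
    by (simp add: quad_def inner_axis' matrix_vector_mult_basis column_def)
  have nn: "0 \<le> A $ k $ k" for k
    using pos_semidef_quad[OF assms, of "axis k 1"] by (simp add: diag)
  have le: "A $ k $ k \<le> trace A" for k
    unfolding trace_def by (rule member_le_sum) (auto simp: nn)
  have "0 \<le> quad A (axis i 1 + c *\<^sub>R axis j 1)" for c
    by (rule pos_semidef_quad[OF assms])
  then have "0 \<le> A $ i $ i + 2 * (c * A $ i $ j) + c\<^sup>2 * A $ j $ j" for c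
    by (simp add: quad_vector_add[OF sym] diag quad_vector_scaleR matrix_vector_mult_scaleR
        inner_axis' matrix_vector_mult_basis column_def)
  from this[of 1] this[of "-1"] le[of i] le[of j] show ?thesis by auto
qed

section \<open>Continuity of matrix operations\<close>

lemma tendsto_matrix_vector_mult [tendsto_intros]:
  fixes f :: "'a \<Rightarrow> real^'m^'k"
  assumes "(f \<longlongrightarrow> A) F" "(g \<longlongrightarrow> x) F"
  shows "((\<lambda>t. f t *v g t) \<longlongrightarrow> A *v x) F"
  unfolding matrix_vector_mult_def by (intro tendsto_intros assms)

lemma tendsto_vector_matrix_mult [tendsto_intros]:
  fixes f :: "'a \<Rightarrow> real^'m^'k"
  assumes "(f \<longlongrightarrow> A) F" "(g \<longlongrightarrow> x) F"
  shows "((\<lambda>t. g t v* f t) \<longlongrightarrow> x v* A) F"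
  unfolding vector_matrix_mult_def by (intro tendsto_intros assms)

lemma tendsto_matrix_mult [tendsto_intros]:
  fixes f :: "'a \<Rightarrow> real^'m^'k" and g :: "'a \<Rightarrow> real^'l^'m"
  assumes "(f \<longlongrightarrow> A) F" "(g \<longlongrightarrow> B) F"
  shows "((\<lambda>t. f t ** g t) \<longlongrightarrow> A ** B) F"
  unfolding matrix_matrix_mult_def by (intro tendsto_intros assms)

lemma tendsto_transpose [tendsto_intros]:
  fixes f :: "'a \<Rightarrow> real^'m^'k"
  assumes "(f \<longlongrightarrow> A) F"
  shows "((\<lambda>t. transpose (f t)) \<longlongrightarrow> transpose A) F"
  unfolding transpose_def by (intro tendsto_intros assms)

lemma tendsto_quad [tendsto_intros]:
  assumes "(f \<longlongrightarrow> A) F" "(g \<longlongrightarrow> x) F"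
  shows "((\<lambda>t. quad (f t) (g t)) \<longlongrightarrow> quad A x) F"
  unfolding quad_def by (intro tendsto_intros assms)

lemma tendsto_det [tendsto_intros]:
  fixes f :: "'a \<Rightarrow> real^'k^'k"
  assumes "(f \<longlongrightarrow> A) F"
  shows "((\<lambda>t. det (f t)) \<longlongrightarrow> det A) F"
  unfolding det_def by (intro tendsto_intros assms)

text \<open>Cramer's rule writes the solution of a linear system as a quotient of polynomials in the
  entries, hence as a continuous function wherever the determinant does not vanish.\<close>

lemma tendsto_matrix_inv_vector:
  fixes f :: "'a \<Rightarrow> real^'k^'k"
  assumes f: "(f \<longlongrightarrow> A) F" and g: "(g \<longlongrightarrow> b) F" and "invertible A"
  shows "((\<lambda>t. matrix_inv (f t) *v g t) \<longlongrightarrow> matrix_inv A *v b) F"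
proof -
  define sol where
    "sol M v = (\<chi> k. det (\<chi> i j. if j = k then v $ i else M $ i $ j) / det M)"
    for M :: "real^'k^'k" and v
  have sol: "matrix_inv M *v v = sol M v" if "det M \<noteq> 0" for M v
    using cramer[OF that, of "matrix_inv M *v v" v] that
    by (simp add: sol_def matrix_inv_vector_cancel invertible_det_nz)
  have nz: "det A \<noteq> 0" using \<open>invertible A\<close> by (simp add: invertible_det_nz)
  have num: "((\<lambda>t. (\<chi> i j. if j = k then g t $ i else f t $ i $ j) :: real^'k^'k) \<longlongrightarrow>
      (\<chi> i j. if j = k then b $ i else A $ i $ j)) F" for k
    by (intro tendsto_vec_lambda) (auto intro!: tendsto_intros f g)
  have "((\<lambda>t. sol (f t) (g t)) \<longlongrightarrow> sol A b) F"
    unfolding sol_def by (intro tendsto_intros num f nz)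
  moreover have "\<forall>\<^sub>F t in F. sol (f t) (g t) = matrix_inv (f t) *v g t"
    using tendsto_imp_eventually_ne[OF tendsto_det[OF f] nz]
    by eventually_elim (simp add: sol)
  ultimately show ?thesis
    by (simp add: sol[OF nz] Lim_transform_eventually)
qed

section \<open>The positive definite square root\<close>

text \<open>For \<open>D = B - C\<close> the hypothesis says \<open>B D + D C = 0\<close>. Multiplying by \<open>D\<close> and taking traces
  gives \<open>tr (D B D) + tr (D C D) = 0\<close>, a sum of two nonnegative terms, and \<open>tr (D B D)\<close>
  vanishes only for \<open>D = 0\<close>.\<close>

lemma pos_def_sqrt_unique:
  fixes B C :: "real^'k^'k"
  assumes B: "pos_def B" and C: "pos_def C" and eq: "B ** B = C ** C"
  shows "B = C"
proof -
  define D where "D = B - C"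
  have symB: "transpose B = B" and symC: "transpose C = C"
    using B C by (auto simp: pos_def_def)
  have symD: "transpose D = D"
    using symB symC by (simp add: D_def transpose_def vec_eq_iff)
  have BD: "B *v (D *v x) + D *v (C *v x) = 0" for x
  proof -
    have "B *v (B *v x) = C *v (C *v x)" by (simp add: matrix_vector_mul_assoc eq)
    then show ?thesis by (simp add: D_def algebra_simps)
  qed
  define r where "r E = (\<Sum>i\<in>UNIV. quad E (D *v axis i 1))" for E
  have "r B + r C = 0"
  proof -
    have "r C = trace (D ** (C ** D))"
      by (simp add: r_def trace_symmetric_sandwich[OF symD] matrix_mul_assoc)
    also have "\<dots> = trace ((C ** D) ** D)" by (rule trace_mul_sym)
    also have "\<dots> = trace (D ** (D ** C))"
      by (metis matrix_mul_assoc trace_mul_sym)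
    finally have "r B + r C = trace (D ** (B ** D)) + trace (D ** (D ** C))"
      by (simp add: r_def trace_symmetric_sandwich[OF symD] matrix_mul_assoc)
    also have "\<dots> = trace (D ** (B ** D + D ** C))"
      by (simp add: trace_add matrix_add_ldistrib)
    also have "B ** D + D ** C = 0"
      using BD by (simp add: matrix_eq matrix_vector_mult_add_rdistrib matrix_vector_mul_assoc)
    finally show ?thesis by (simp add: trace_def matrix_matrix_mult_def)
  qed
  moreover have "0 \<le> r C"
    unfolding r_def by (intro sum_nonneg pos_semidef_quad pos_def_imp_pos_semidef C)
  moreover have nn: "0 \<le> quad B (D *v axis i 1)" for i
    by (intro pos_semidef_quad pos_def_imp_pos_semidef B)
  then have "0 \<le> r B" unfolding r_def by (intro sum_nonneg)
  ultimately have "r B = 0" by linarith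
  then have "quad B (D *v axis i 1) = 0" for i
    using nn by (simp add: r_def sum_nonneg_eq_0_iff)
  then have "D *v axis i 1 = 0" for i
    using pos_def_quad_pos[OF B] by (metis less_irrefl)
  then have "D = 0"
    by (simp add: matrix_vector_mult_basis column_def vec_eq_iff)
  then show ?thesis by (simp add: D_def)
qed

text \<open>After rescaling, \<open>A / L = I - C\<close> with a nonexpansive matrix \<open>C\<close>, and
  \<open>(I - Y)\<^sup>2 = I - C\<close> is equivalent to the fixed point equation \<open>Y = (C + Y\<^sup>2) / 2\<close>. The right-hand
  side maps the compact convex set of symmetric nonexpansive matrices into itself, so Brouwer's theorem
  yields \<open>Y\<close>. The root \<open>I - Y\<close> is semidefinite because \<open>Y\<close> is nonexpansive, and definite
  because its square is injective.\<close>

lemma pos_def_sqrt_exists: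
  fixes A :: "real^'k^'k"
  assumes A: "pos_def A"
  shows "\<exists>B. pos_def B \<and> B ** B = A"
proof -
  have symA: "transpose A = A" using A by (simp add: pos_def_def)
  obtain L where L: "L > 0" "\<And>x. norm (A *v x) \<le> norm x * L"
    using bounded_linear.pos_bounded[OF matrix_vector_mul_bounded_linear[of A]] by blast
  define C where "C = mat 1 - (1 / L) *\<^sub>R A"
  have Cv: "C *v x = x - (1 / L) *\<^sub>R (A *v x)" for x
    by (simp add: C_def algebra_simps flip: scaleR_matrix_vector_assoc)
  have symC: "transpose C = C"
    using symA by (simp add: C_def transpose_def vec_eq_iff mat_def)
  have normC: "norm (C *v x) \<le> norm x" for x
  proof -
    let ?y = "A *v x"
    \<comment> \<open>Semidefiniteness at this vector gives \<open>\<bar>A x\<bar>\<^sup>2 \<le> L (x \<bullet> A x)\<close>, which makes \<open>C\<close> nonexpansive.\<close>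
    have "0 \<le> quad A (x + (- 1 / L) *\<^sub>R ?y)"
      by (intro pos_semidef_quad pos_def_imp_pos_semidef A)
    then have 1: "0 \<le> quad A x - (2 / L) * (?y \<bullet> ?y) + (1 / L)\<^sup>2 * (?y \<bullet> (A *v ?y))"
      unfolding quad_vector_add[OF symA] quad_vector_scaleR matrix_vector_mult_scaleR
        inner_scaleR_right inner_symmetric[OF symA, of x ?y, symmetric]
      by (simp add: quad_def)
    have "?y \<bullet> (A *v ?y) \<le> norm ?y * norm (A *v ?y)" by (rule norm_cauchy_schwarz)
    also have "\<dots> \<le> norm ?y * (norm ?y * L)" by (intro mult_left_mono L) simp
    also have "\<dots> = L * (?y \<bullet> ?y)" by (simp add: dot_square_norm power2_eq_square)
    finally have "(1 / L)\<^sup>2 * (?y \<bullet> (A *v ?y)) \<le> (1 / L)\<^sup>2 * (L * (?y \<bullet> ?y))"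
      by (intro mult_left_mono) auto
    also have "\<dots> = (1 / L) * (?y \<bullet> ?y)" using L(1) by (simp add: power2_eq_square)
    finally have 2: "(1 / L) * (?y \<bullet> ?y) \<le> quad A x" using 1 by (simp add: field_simps)
    have "(C *v x) \<bullet> (C *v x) = x \<bullet> x - (2 / L) * quad A x + (1 / L) * ((1 / L) * (?y \<bullet> ?y))"
      by (simp add: Cv inner_diff_left inner_diff_right quad_def inner_commute[of ?y x]
          algebra_simps)
    also have "\<dots> \<le> x \<bullet> x - (2 / L) * quad A x + (1 / L) * quad A x"
      using 2 L(1) by (intro add_left_mono mult_left_mono) auto
    also have "\<dots> = x \<bullet> x - (1 / L) * quad A x" by (simp add: algebra_simps)
    also have "\<dots> \<le> x \<bullet> x"
      using L(1) pos_semidef_quad[OF pos_def_imp_pos_semidef[OF A], of x] by simp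
    finally show ?thesis by (simp add: norm_le)
  qed
  define K where "K = {Y :: real^'k^'k. transpose Y = Y \<and> (\<forall>x. norm (Y *v x) \<le> norm x)}"
  have "bounded K"
  proof (rule boundedI)
    fix Y assume Y: "Y \<in> K"
    have "\<bar>Y $ i $ j\<bar> \<le> 1" for i j
    proof -
      have "\<bar>Y $ i $ j\<bar> \<le> norm (Y *v axis j 1)"
        using component_le_norm_cart[of "Y *v axis j 1" i]
        by (simp add: matrix_vector_mult_basis column_def)
      also have "\<dots> \<le> norm (axis j 1 :: real^'k)" using Y unfolding K_def by blast
      finally show ?thesis by simp
    qed
    then show "norm Y \<le> real CARD('k) * (real CARD('k) * 1)" by (rule norm_matrix_le_entries)
  qed
  moreover have "closed K"
  proof (unfold closed_sequential_limits, intro allI impI, elim conjE)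
    fix Y l assume Y: "\<forall>n. Y n \<in> K" and lim: "Y \<longlonglongrightarrow> l"
    have "(\<lambda>n. transpose (Y n)) \<longlonglongrightarrow> transpose l" by (intro tendsto_intros lim)
    then have "Y \<longlonglongrightarrow> transpose l" using Y by (simp add: K_def)
    with lim have "transpose l = l" using LIMSEQ_unique by blast
    moreover have "norm (l *v x) \<le> norm x" for x
    proof (rule LIMSEQ_le_const2)
      show "(\<lambda>n. norm (Y n *v x)) \<longlonglongrightarrow> norm (l *v x)" by (intro tendsto_intros lim)
      show "\<exists>N. \<forall>n\<ge>N. norm (Y n *v x) \<le> norm x" using Y by (simp add: K_def)
    qed
    ultimately show "l \<in> K" by (simp add: K_def)
  qed
  ultimately have "compact K" by (simp add: compact_eq_bounded_closed)
  moreover have "convex K"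
  proof (rule convexI)
    fix X Y :: "real^'k^'k" and u v :: real
    assume X: "X \<in> K" and Y: "Y \<in> K" and uv: "0 \<le> u" "0 \<le> v" "u + v = 1"
    have "norm ((u *\<^sub>R X + v *\<^sub>R Y) *v x) \<le> norm x" for x
    proof -
      have "norm ((u *\<^sub>R X + v *\<^sub>R Y) *v x) \<le> norm (u *\<^sub>R (X *v x)) + norm (v *\<^sub>R (Y *v x))"
        by (simp only: matrix_vector_mult_add_rdistrib flip: scaleR_matrix_vector_assoc)
          (rule norm_triangle_ineq)
      also have "\<dots> \<le> u * norm x + v * norm x"
        using X Y uv by (auto simp: K_def intro!: add_mono mult_left_mono)
      also have "\<dots> = norm x" using uv by (simp flip: distrib_right)
      finally show ?thesis .
    qed
    then show "u *\<^sub>R X + v *\<^sub>R Y \<in> K"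
      using X Y by (simp add: K_def transpose_add transpose_scalar)
  qed
  moreover have "K \<noteq> {}" using symC normC by (auto simp: K_def)
  moreover have "continuous_on K (\<lambda>Y. (1/2) *\<^sub>R (C + Y ** Y))"
    unfolding continuous_on_def by (intro ballI tendsto_intros)
  moreover have "(\<lambda>Y. (1/2) *\<^sub>R (C + Y ** Y)) \<in> K \<rightarrow> K"
  proof
    fix Y assume Y: "Y \<in> K"
    have "norm (((1/2) *\<^sub>R (C + Y ** Y)) *v x) \<le> norm x" for x
    proof -
      have "norm (Y *v (Y *v x)) \<le> norm x" using Y unfolding K_def by (blast intro: order_trans)
      then have "norm (C *v x + Y *v (Y *v x)) \<le> 2 * norm x"
        using normC[of x] norm_triangle_ineq[of "C *v x" "Y *v (Y *v x)"] by linarith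
      moreover have "((1/2) *\<^sub>R (C + Y ** Y)) *v x = (1/2) *\<^sub>R (C *v x + Y *v (Y *v x))"
        by (simp only: matrix_vector_mult_add_rdistrib matrix_vector_mul_assoc
            flip: scaleR_matrix_vector_assoc)
      ultimately show ?thesis by simp
    qed
    then show "(1/2) *\<^sub>R (C + Y ** Y) \<in> K"
      using Y symC by (simp add: K_def transpose_add transpose_scalar matrix_transpose_mul)
  qed
  ultimately obtain Y where Y: "Y \<in> K" and fixp: "(1/2) *\<^sub>R (C + Y ** Y) = Y"
    by (rule brouwer)
  have Yv: "C *v x + Y *v (Y *v x) = 2 *\<^sub>R (Y *v x)" for x
    using arg_cong[OF fixp, of "\<lambda>M. 2 *\<^sub>R (M *v x)"]
    by (simp add: matrix_vector_mult_add_rdistrib matrix_vector_mul_assoc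
        flip: scaleR_matrix_vector_assoc)
  define B where "B = sqrt L *\<^sub>R (mat 1 - Y)"
  have Bv: "B *v x = sqrt L *\<^sub>R (x - Y *v x)" for x
    by (simp add: B_def algebra_simps flip: scaleR_matrix_vector_assoc)
  have BBv: "B *v (B *v x) = A *v x" for x
  proof -
    have "B *v (B *v x) = L *\<^sub>R (x - 2 *\<^sub>R (Y *v x) + Y *v (Y *v x))"
      using L(1) by (simp add: Bv algebra_simps scaleR_2)
    also have "\<dots> = L *\<^sub>R (x - C *v x)" by (simp flip: Yv)
    also have "\<dots> = A *v x" using L(1) by (simp add: Cv)
    finally show ?thesis .
  qed
  have "pos_def B"
    unfolding pos_def_def
  proof (intro conjI allI impI)
    show "transpose B = B"
      using Y by (simp add: K_def B_def transpose_def vec_eq_iff mat_def)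
    fix x :: "real^'k" assume x: "x \<noteq> 0"
    have le: "(Y *v x) \<bullet> (Y *v x) \<le> x \<bullet> x" using Y by (simp add: K_def norm_le)
    \<comment> \<open>The strict inequality below is \<open>\<bar>x - Y x\<bar>\<^sup>2 > 0\<close> combined with \<open>\<bar>Y x\<bar> \<le> \<bar>x\<bar>\<close>.\<close>
    have "x \<noteq> Y *v x"
    proof
      assume "x = Y *v x"
      then have "B *v x = 0" by (simp add: Bv)
      then have "A *v x = 0" using BBv[of x] by simp
      then show False using pos_def_quad_pos[OF A x] by (simp add: quad_def)
    qed
    then have "0 < (x - Y *v x) \<bullet> (x - Y *v x)" by simp
    also have "\<dots> = x \<bullet> x - 2 * (x \<bullet> (Y *v x)) + (Y *v x) \<bullet> (Y *v x)"
      by (simp add: inner_diff_left inner_diff_right inner_commute)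
    finally have "0 < x \<bullet> x - x \<bullet> (Y *v x)" using le by linarith
    then show "0 < x \<bullet> (B *v x)" using L(1) by (simp add: Bv inner_diff_right)
  qed
  moreover have "B ** B = A"
    using BBv by (simp add: matrix_eq matrix_vector_mul_assoc)
  ultimately show ?thesis by blast
qed

lemma mat_sqrt:
  assumes "pos_def A"
  shows "pos_def (mat_sqrt A)" "mat_sqrt A ** mat_sqrt A = A"
proof -
  have "\<exists>!B. pos_def B \<and> B ** B = A"
    using pos_def_sqrt_exists[OF assms] pos_def_sqrt_unique by metis
  from theI'[OF this] show "pos_def (mat_sqrt A)" "mat_sqrt A ** mat_sqrt A = A"
    by (auto simp: mat_sqrt_def)
qed

section \<open>Linear estimation of a single functional\<close>

text \<open>Suppose that \<open>b \<bullet> \<theta>\<close> is estimated by \<open>a \<bullet> y\<close> with \<open>y = T \<theta> + w\<close>. If \<open>\<theta>\<close> has second moment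
  matrix \<open>M\<close> and the noise, centred given \<open>\<theta>\<close>, has covariance \<open>\<Sigma>\<close>, then this is the mean squared
  error: the bias \<open>(T\<^sup>T a - b) \<bullet> \<theta>\<close> contributes the first term. It is affine in \<open>M\<close>, and a
  deterministic \<open>\<theta>\<close> is the rank-one case \<open>M = \<theta> \<theta>\<^sup>T\<close>.\<close>
definition lin_risk :: "real^'n^'n \<Rightarrow> real^'d^'n \<Rightarrow> real^'d^'d \<Rightarrow> real^'n \<Rightarrow> real^'d \<Rightarrow> real" where
  "lin_risk \<Sigma> T M a b = quad M (a v* T - b) + quad \<Sigma> a"

definition obs_cov :: "real^'d^'d \<Rightarrow> real^'n^'n \<Rightarrow> real^'d^'n \<Rightarrow> real^'n^'n" where
  "obs_cov \<Omega> \<Sigma> T = T ** \<Omega> ** transpose T + \<Sigma>"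

text \<open>This is the best linear weight for the prior covariance \<open>\<Omega>\<close>, the familiar
  \<open>(T \<Omega> T\<^sup>T + \<Sigma>)\<^sup>-\<^sup>1 T \<Omega> b\<close>. In this form it makes sense, and is continuous, also for singular \<open>\<Omega>\<close>,
  where \<open>\<Omega>\<^sup>-\<^sup>1\<close> is not available.\<close>
definition gain :: "real^'d^'d \<Rightarrow> real^'n^'n \<Rightarrow> real^'d^'n \<Rightarrow> real^'d \<Rightarrow> real^'n" where
  "gain \<Omega> \<Sigma> T b = matrix_inv (obs_cov \<Omega> \<Sigma> T) *v (T *v (\<Omega> *v b))"

definition outer :: "real^'d \<Rightarrow> real^'d^'d" where
  "outer \<theta> = (\<chi> i j. \<theta> $ i * \<theta> $ j)"

lemma quad_outer: "quad (outer \<theta>) x = (\<theta> \<bullet> x)\<^sup>2"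
proof -
  have "outer \<theta> *v x = (\<theta> \<bullet> x) *\<^sub>R \<theta>"
    by (simp add: outer_def matrix_vector_mult_def vec_eq_iff inner_vec_def sum_distrib_left
        mult_ac)
  then show ?thesis by (simp add: quad_def power2_eq_square inner_commute)
qed

lemma pos_semidef_outer: "pos_semidef (outer \<theta>)"
  by (simp add: pos_semidef_def quad_outer) (simp add: outer_def transpose_def vec_eq_iff mult.commute)

lemma lin_risk_nonneg: "pos_semidef M \<Longrightarrow> pos_semidef \<Sigma> \<Longrightarrow> 0 \<le> lin_risk \<Sigma> T M a b"
  by (simp add: lin_risk_def pos_semidef_quad)

lemma lin_risk_mixture:
  "lin_risk \<Sigma> T ((1 - t) *\<^sub>R M + t *\<^sub>R M') a b
     = (1 - t) * lin_risk \<Sigma> T M a b + t * lin_risk \<Sigma> T M' a b"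
  by (simp only: lin_risk_def quad_add quad_scaleR) (simp add: algebra_simps)

lemma pos_def_obs_cov: "pos_semidef \<Omega> \<Longrightarrow> pos_def \<Sigma> \<Longrightarrow> pos_def (obs_cov \<Omega> \<Sigma> T)"
  unfolding obs_cov_def by (intro pos_def_add_pos_semidef pos_semidef_congruence)

lemma quad_obs_cov: "quad (obs_cov \<Omega> \<Sigma> T) a = quad \<Omega> (a v* T) + quad \<Sigma> a"
  by (simp add: obs_cov_def quad_add quad_congruence)

text \<open>Completing the square: with \<open>W = T \<Omega> T\<^sup>T + \<Sigma>\<close> and \<open>g\<close> the gain, so that \<open>W g = T \<Omega> b\<close>, the risk
  of \<open>a\<close> exceeds that of \<open>g\<close> by \<open>(a - g)\<^sup>T W (a - g)\<close>.\<close>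

lemma lin_risk_gain_le:
  assumes \<Omega>: "pos_semidef \<Omega>" and \<Sigma>: "pos_def \<Sigma>"
  shows "lin_risk \<Sigma> T \<Omega> (gain \<Omega> \<Sigma> T b) b \<le> lin_risk \<Sigma> T \<Omega> a b"
proof -
  let ?W = "obs_cov \<Omega> \<Sigma> T" and ?g = "gain \<Omega> \<Sigma> T b"
  note W = pos_def_obs_cov[OF \<Omega> \<Sigma>, of T]
  have symW: "transpose ?W = ?W" using W by (simp add: pos_def_def)
  have sym: "transpose \<Omega> = \<Omega>" using \<Omega> by (simp add: pos_semidef_def)
  have Wg: "?W *v ?g = T *v (\<Omega> *v b)"
    by (simp add: gain_def matrix_inv_vector_cancel pos_def_invertible W)
  have expand: "lin_risk \<Sigma> T \<Omega> x b = quad ?W x - 2 * (x \<bullet> (?W *v ?g)) + quad \<Omega> b" for x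
    using quad_vector_add[OF sym, of "x v* T" "- b"] quad_vector_scaleR[of \<Omega> "-1" b]
    by (simp add: lin_risk_def quad_obs_cov Wg dot_lmul_matrix linear_neg[OF matrix_vector_mul_linear])
  have "quad ?W (a + - ?g) = quad ?W a - 2 * (a \<bullet> (?W *v ?g)) + quad ?W ?g"
    using quad_vector_add[OF symW, of a "- ?g"] quad_vector_scaleR[of ?W "-1" ?g]
    by (simp add: linear_neg[OF matrix_vector_mul_linear])
  moreover have "0 \<le> quad ?W (a + - ?g)"
    by (intro pos_semidef_quad pos_def_imp_pos_semidef W)
  ultimately show ?thesis by (simp add: expand) (simp add: quad_def)
qed

text \<open>The Bayes risk is the posterior variance. For \<open>s = (\<Omega>\<^sup>-\<^sup>1 + T\<^sup>T \<Sigma>\<^sup>-\<^sup>1 T)\<^sup>-\<^sup>1 b\<close> the vector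
  \<open>a = \<Sigma>\<^sup>-\<^sup>1 T s\<close> satisfies \<open>T\<^sup>T a - b = - \<Omega>\<^sup>-\<^sup>1 s\<close>. It therefore solves the equation that defines the
  gain, and its risk collapses to \<open>b \<bullet> s\<close>; this replaces the Woodbury identity.\<close>

lemma lin_risk_gain:
  fixes T :: "real^'d^'n"
  assumes \<Omega>: "pos_def \<Omega>" and \<Sigma>: "pos_def \<Sigma>"
  shows "lin_risk \<Sigma> T \<Omega> (gain \<Omega> \<Sigma> T b) b
    = quad (matrix_inv (matrix_inv \<Omega> + transpose T ** matrix_inv \<Sigma> ** T)) b"
proof -
  let ?P = "matrix_inv \<Omega> + transpose T ** matrix_inv \<Sigma> ** T"
  have "pos_def (transpose T ** matrix_inv \<Sigma> ** transpose (transpose T) + matrix_inv \<Omega>)"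
    by (intro pos_def_add_pos_semidef pos_semidef_congruence pos_def_imp_pos_semidef
        pos_def_matrix_inv \<Omega> \<Sigma>)
  then have P: "invertible ?P" by (simp add: pos_def_invertible add.commute)
  note inv\<Omega> = matrix_inv_vector_cancel[OF pos_def_invertible[OF \<Omega>]]
  note inv\<Sigma> = matrix_inv_vector_cancel[OF pos_def_invertible[OF \<Sigma>]]
  define s where "s = matrix_inv ?P *v b"
  define a where "a = matrix_inv \<Sigma> *v (T *v s)"
  have "?P *v s = b" by (simp add: s_def matrix_inv_vector_cancel[OF P])
  then have aT: "a v* T = b - matrix_inv \<Omega> *v s"
    by (simp add: a_def algebra_simps flip: matrix_vector_mul_assoc)
  let ?W = "obs_cov \<Omega> \<Sigma> T"
  have "?W *v a = T *v (\<Omega> *v b)"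
    by (simp add: obs_cov_def matrix_vector_mult_add_rdistrib aT inv\<Omega>
        matrix_vector_mult_diff_distrib flip: matrix_vector_mul_assoc)
      (simp add: a_def inv\<Sigma>)
  then have "gain \<Omega> \<Sigma> T b = matrix_inv ?W *v (?W *v a)" by (simp add: gain_def)
  also have "\<dots> = a"
    by (intro matrix_inv_vector_cancel pos_def_invertible pos_def_obs_cov
        pos_def_imp_pos_semidef \<Omega> \<Sigma>)
  finally have g: "gain \<Omega> \<Sigma> T b = a" .
  have "lin_risk \<Sigma> T \<Omega> a b = quad \<Omega> (- (matrix_inv \<Omega> *v s)) + quad \<Sigma> a"
    by (simp add: lin_risk_def aT)
  also have "quad \<Omega> (- (matrix_inv \<Omega> *v s)) = (matrix_inv \<Omega> *v s) \<bullet> s"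
    by (simp add: quad_def linear_neg[OF matrix_vector_mul_linear] inv\<Omega>)
  also have "quad \<Sigma> a = a \<bullet> (T *v s)" by (simp add: quad_def a_def inv\<Sigma>)
  also have "\<dots> = (b - matrix_inv \<Omega> *v s) \<bullet> s" by (simp add: aT flip: dot_lmul_matrix)
  finally show ?thesis by (simp add: g quad_def s_def inner_diff_left)
qed

lemma tendsto_gain [tendsto_intros]:
  assumes "(f \<longlongrightarrow> \<Omega>) F" "(g \<longlongrightarrow> T) F" "pos_semidef \<Omega>" "pos_def \<Sigma>"
  shows "((\<lambda>x. gain (f x) \<Sigma> (g x) b) \<longlongrightarrow> gain \<Omega> \<Sigma> T b) F"
  unfolding gain_def
proof (rule tendsto_matrix_inv_vector)
  show "invertible (obs_cov \<Omega> \<Sigma> T)"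
    using assms by (simp add: pos_def_invertible pos_def_obs_cov)
qed (auto simp: obs_cov_def intro!: tendsto_intros assms)

lemma tendsto_lin_risk:
  assumes "(g \<longlongrightarrow> T) F" "(h \<longlongrightarrow> a) F"
  shows "((\<lambda>x. lin_risk \<Sigma> (g x) M (h x) b) \<longlongrightarrow> lin_risk \<Sigma> T M a b) F"
  unfolding lin_risk_def by (intro tendsto_intros assms)

section \<open>The risk of a linear estimator\<close>

definition linear_estimator ::
    "real^'d^'d \<Rightarrow> real^'n^'n \<Rightarrow> (real^'d^'n) \<times> (real^'n) \<Rightarrow> real^'d" where
  "linear_estimator \<Omega> \<Sigma> p = \<Omega> *v ((matrix_inv (obs_cov \<Omega> \<Sigma> (fst p)) *v snd p) v* fst p)"

lemma linear_estimator_measurable: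
  fixes \<Sigma> :: "real^'n^'n" and \<Omega> :: "real^'d^'d"
  assumes "pos_semidef \<Omega>" "pos_def \<Sigma>"
  shows "linear_estimator \<Omega> \<Sigma> \<in> borel_measurable borel"
proof (rule borel_measurable_continuous_onI)
  have "((\<lambda>p. matrix_inv (obs_cov \<Omega> \<Sigma> (fst p)) *v snd p) \<longlongrightarrow>
      matrix_inv (obs_cov \<Omega> \<Sigma> (fst q)) *v snd q) (at q)"
    for q :: "(real^'d^'n) \<times> (real^'n)"
  proof (rule tendsto_matrix_inv_vector)
    show "invertible (obs_cov \<Omega> \<Sigma> (fst q))"
      using assms by (simp add: pos_def_invertible pos_def_obs_cov)
  qed (auto simp: obs_cov_def intro!: tendsto_intros)
  note lim = this
  show "continuous_on UNIV (linear_estimator \<Omega> \<Sigma> :: (real^'d^'n) \<times> (real^'n) \<Rightarrow> _)"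
    unfolding continuous_on_def linear_estimator_def
    by (rule ballI, rule tendsto_matrix_vector_mult[OF tendsto_const],
        rule tendsto_vector_matrix_mult[OF _ lim]) (intro tendsto_intros)
qed

text \<open>The gain depends linearly on \<open>b\<close>, say as \<open>A\<^sup>T b\<close>, and the estimator is \<open>y \<mapsto> A y\<close>. Hence one
  vector estimator realises the best linear estimators of all functionals \<open>b \<bullet> \<theta>\<close> at once.\<close>

lemma inner_linear_estimator:
  assumes "pos_semidef \<Omega>" "pos_def \<Sigma>"
  shows "b \<bullet> linear_estimator \<Omega> \<Sigma> (T, y) = gain \<Omega> \<Sigma> T b \<bullet> y"
proof -
  have sym\<Omega>: "transpose \<Omega> = \<Omega>" using assms by (simp add: pos_semidef_def)
  let ?V = "matrix_inv (obs_cov \<Omega> \<Sigma> T)"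
  have symV: "transpose ?V = ?V"
    using pos_def_matrix_inv[OF pos_def_obs_cov[OF assms]] by (simp add: pos_def_def)
  have "b \<bullet> linear_estimator \<Omega> \<Sigma> (T, y) = ((?V *v y) v* T) \<bullet> (\<Omega> *v b)"
    by (simp add: linear_estimator_def inner_commute flip: inner_symmetric[OF sym\<Omega>])
  also have "\<dots> = (?V *v y) \<bullet> (T *v (\<Omega> *v b))" by (rule dot_lmul_matrix)
  also have "\<dots> = y \<bullet> gain \<Omega> \<Sigma> T b" by (simp add: gain_def inner_symmetric[OF symV])
  finally show ?thesis by (simp add: inner_commute)
qed

lemma wnorm_error_linear_estimator:
  assumes "pos_semidef \<Omega>" "pos_def \<Sigma>" "pos_def K"
  defines "b \<equiv> \<lambda>i. mat_sqrt K *v axis i 1"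
  shows "(wnorm K (linear_estimator \<Omega> \<Sigma> (T, T *v \<theta> + w) - \<theta>))\<^sup>2
    = (\<Sum>i\<in>UNIV. (\<theta> \<bullet> (gain \<Omega> \<Sigma> T (b i) v* T - b i) + gain \<Omega> \<Sigma> T (b i) \<bullet> w)\<^sup>2)"
proof -
  let ?v = "linear_estimator \<Omega> \<Sigma> (T, T *v \<theta> + w) - \<theta>"
  have "(wnorm K ?v)\<^sup>2 = quad K ?v"
    using pos_semidef_quad[OF pos_def_imp_pos_semidef[OF assms(3)], of ?v]
    by (simp add: wnorm_def quad_def)
  also have "\<dots> = quad (mat_sqrt K ** mat_sqrt K) ?v"
    by (simp add: mat_sqrt assms)
  also have "\<dots> = (\<Sum>i\<in>UNIV. (b i \<bullet> ?v)\<^sup>2)"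
    unfolding b_def using mat_sqrt(1)[OF assms(3)]
    by (intro quad_square_sum) (simp add: pos_def_def)
  finally have sum: "(wnorm K ?v)\<^sup>2 = (\<Sum>i\<in>UNIV. (b i \<bullet> ?v)\<^sup>2)" .
  have "b i \<bullet> ?v
      = \<theta> \<bullet> (gain \<Omega> \<Sigma> T (b i) v* T - b i) + gain \<Omega> \<Sigma> T (b i) \<bullet> w" for i
    using dot_lmul_matrix[of "gain \<Omega> \<Sigma> T (b i)" T \<theta>]
    by (simp add: inner_diff_right inner_linear_estimator[OF assms(1,2)] inner_add_right
        inner_commute[of \<theta> "gain \<Omega> \<Sigma> T (b i) v* T"] inner_commute[of \<theta> "b i"])
  then show ?thesis by (simp add: sum)
qed

lemma nn_integral_joint_law:
  assumes \<nu>: "\<nu> \<in> P \<rightarrow>\<^sub>M prob_algebra borel" and f: "f \<in> borel_measurable (P \<Otimes>\<^sub>M borel)"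
  shows "(\<integral>\<^sup>+z. f z \<partial>joint_law P \<nu>) = (\<integral>\<^sup>+\<xi>. \<integral>\<^sup>+w. f (\<xi>, w) \<partial>\<nu> \<xi> \<partial>P)"
proof -
  note \<nu>' = measurable_prob_algebraD[OF \<nu>]
  have "(\<integral>\<^sup>+z. f z \<partial>joint_law P \<nu>)
      = (\<integral>\<^sup>+\<xi>. \<integral>\<^sup>+z. f z \<partial>(\<nu> \<xi> \<bind> (\<lambda>w. return (P \<Otimes>\<^sub>M borel) (\<xi>, w))) \<partial>P)"
    unfolding joint_law_def
  proof (rule nn_integral_bind[OF f])
    show "(\<lambda>\<xi>. \<nu> \<xi> \<bind> (\<lambda>w. return (P \<Otimes>\<^sub>M borel) (\<xi>, w))) \<in> P \<rightarrow>\<^sub>M subprob_algebra (P \<Otimes>\<^sub>M borel)"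
      by (rule measurable_bind[OF \<nu>']) simp
  qed
  also have "\<dots> = (\<integral>\<^sup>+\<xi>. \<integral>\<^sup>+w. f (\<xi>, w) \<partial>\<nu> \<xi> \<partial>P)"
  proof (rule nn_integral_cong)
    fix \<xi> assume \<xi>: "\<xi> \<in> space P"
    have [measurable_cong]: "sets (\<nu> \<xi>) = sets borel"
      using measurable_space[OF \<nu> \<xi>] by (simp add: space_prob_algebra)
    have "(\<integral>\<^sup>+z. f z \<partial>(\<nu> \<xi> \<bind> (\<lambda>w. return (P \<Otimes>\<^sub>M borel) (\<xi>, w))))
        = (\<integral>\<^sup>+w. \<integral>\<^sup>+z. f z \<partial>return (P \<Otimes>\<^sub>M borel) (\<xi>, w) \<partial>\<nu> \<xi>)"
      using \<xi> by (intro nn_integral_bind[OF f]) measurable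
    also have "\<dots> = (\<integral>\<^sup>+w. f (\<xi>, w) \<partial>\<nu> \<xi>)"
      using \<xi> f by (intro nn_integral_cong nn_integral_return) (auto simp: space_pair_measure)
    finally show "(\<integral>\<^sup>+z. f z \<partial>(\<nu> \<xi> \<bind> (\<lambda>w. return (P \<Otimes>\<^sub>M borel) (\<xi>, w))))
        = (\<integral>\<^sup>+w. f (\<xi>, w) \<partial>\<nu> \<xi>)" .
  qed
  finally show ?thesis .
qed

text \<open>The cross term \<open>2 c (a \<bullet> w)\<close> has mean zero, so that bias and noise contribute separately. Only
  the bound on the second moment of \<open>a \<bullet> w\<close> enters, which is why all noise laws of the class are
  covered by one inequality.\<close>

lemma second_moment_shifted_le:
  fixes N :: "(real^'n) measure"
  assumes N: "prob_space N" and sets: "sets N = sets borel"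
    and int: "integrable N (\<lambda>w. w)" and mean: "(\<integral>w. w \<partial>N) = 0"
    and var: "(\<integral>\<^sup>+w. ennreal ((a \<bullet> w)\<^sup>2) \<partial>N) \<le> ennreal q" and q: "0 \<le> q"
  shows "(\<integral>\<^sup>+w. ennreal ((c + a \<bullet> w)\<^sup>2) \<partial>N) \<le> ennreal (c\<^sup>2 + q)"
proof -
  interpret prob_space N by fact
  note [measurable_cong] = sets
  have i1: "integrable N (\<lambda>w. a \<bullet> w)" using int by simp
  have m1: "(\<integral>w. a \<bullet> w \<partial>N) = 0" using mean int by simp
  have "(\<integral>\<^sup>+w. ennreal ((a \<bullet> w)\<^sup>2) \<partial>N) < \<infinity>"
    using var by (rule order.strict_trans1) simp
  then have i2: "integrable N (\<lambda>w. (a \<bullet> w)\<^sup>2)"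
    by (intro integrableI_bounded) (auto, measurable)
  then have m2: "(\<integral>w. (a \<bullet> w)\<^sup>2 \<partial>N) \<le> q"
    using var q by (simp add: nn_integral_eq_integral)
  have eq: "(c + a \<bullet> w)\<^sup>2 = c\<^sup>2 + (2 * c) * (a \<bullet> w) + (a \<bullet> w)\<^sup>2" for w
    by (simp add: power2_sum)
  have "integrable N (\<lambda>w. (c + a \<bullet> w)\<^sup>2)"
    unfolding eq using i1 i2 by simp
  then have "(\<integral>\<^sup>+w. ennreal ((c + a \<bullet> w)\<^sup>2) \<partial>N) = ennreal (\<integral>w. (c + a \<bullet> w)\<^sup>2 \<partial>N)"
    by (intro nn_integral_eq_integral) auto
  also have "(\<integral>w. (c + a \<bullet> w)\<^sup>2 \<partial>N) = c\<^sup>2 + (\<integral>w. (a \<bullet> w)\<^sup>2 \<partial>N)"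
    unfolding eq using i1 i2 m1 by (simp add: prob_space)
  also have "ennreal \<dots> \<le> ennreal (c\<^sup>2 + q)" using m2 by (intro ennreal_leI) simp
  finally show ?thesis .
qed

text \<open>The arguments \<open>M\<close> and \<open>\<Omega>\<close> are kept apart: the linear estimator is tuned to \<open>\<Omega>\<close>, while the
  parameter has second moments \<open>M\<close>. The diagonal \<open>M = \<Omega>\<close> is the objective maximised in \<open>\<Phi>\<close>, and
  \<open>M = \<theta> \<theta>\<^sup>T\<close> bounds the risk at \<open>\<theta>\<close>.\<close>
definition mean_risk ::
    "real^'n^'n \<Rightarrow> ('x \<Rightarrow> real^'d^'n) \<Rightarrow> 'x measure \<Rightarrow> real^'d^'d \<Rightarrow> real^'d^'d \<Rightarrow> real^'d^'d \<Rightarrow> ennreal"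
  where "mean_risk \<Sigma> T P B M \<Omega> =
    (\<integral>\<^sup>+\<xi>. ennreal (\<Sum>i\<in>UNIV. lin_risk \<Sigma> (T \<xi>) M (gain \<Omega> \<Sigma> (T \<xi>) (B *v axis i 1)) (B *v axis i 1)) \<partial>P)"

lemma sum_lin_risk_measurable:
  fixes T :: "'x \<Rightarrow> real^'d^'n"
  assumes T: "T \<in> borel_measurable P" and "pos_semidef \<Omega>" "pos_def \<Sigma>"
  shows "(\<lambda>\<xi>. ennreal (\<Sum>i\<in>UNIV. lin_risk \<Sigma> (T \<xi>) M (gain \<Omega> \<Sigma> (T \<xi>) (b i)) (b i)))
    \<in> borel_measurable P"
proof -
  have "(\<lambda>T. \<Sum>i\<in>UNIV. lin_risk \<Sigma> T M (gain \<Omega> \<Sigma> T (b i)) (b i)) \<in> borel_measurable borel"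
    by (intro borel_measurable_continuous_onI)
      (auto simp: continuous_on_def intro!: tendsto_intros tendsto_lin_risk assms)
  from measurable_compose[OF T this] show ?thesis by simp
qed

lemma risk_linear_estimator_le:
  fixes T :: "'x \<Rightarrow> real^'d^'n"
  assumes T [measurable]: "T \<in> borel_measurable P"
    and \<Omega>: "pos_semidef \<Omega>" and \<Sigma>: "pos_def \<Sigma>" and K: "pos_def K"
    and \<nu>: "\<nu> \<in> noise_class P \<Sigma>"
  shows "risk T P K (linear_estimator \<Omega> \<Sigma>) \<theta> \<nu> \<le> mean_risk \<Sigma> T P (mat_sqrt K) (outer \<theta>) \<Omega>"
proof -
  have \<nu>m: "\<nu> \<in> P \<rightarrow>\<^sub>M prob_algebra borel" using \<nu> by (simp add: noise_class_def)
  define b where "b i = mat_sqrt K *v axis i 1" for i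
  note [measurable] = linear_estimator_measurable[OF \<Omega> \<Sigma>]
  have [measurable]: "wnorm K \<in> borel_measurable borel"
    unfolding wnorm_def
    by (intro borel_measurable_continuous_onI)
      (auto simp: continuous_on_def intro!: tendsto_intros)
  have lin [measurable]: "(\<lambda>z. T (fst z) *v \<theta> + snd z) \<in> borel_measurable (P \<Otimes>\<^sub>M borel)"
  proof -
    have "(\<lambda>M :: real^'d^'n. M *v \<theta>) \<in> borel_measurable borel"
      by (intro borel_measurable_continuous_onI)
        (auto simp: continuous_on_def intro!: tendsto_intros)
    then have [measurable]: "(\<lambda>\<xi>. T \<xi> *v \<theta>) \<in> borel_measurable P"
      by (rule measurable_compose[OF T])
    show ?thesis by measurable
  qed
  have meas: "(\<lambda>(\<xi>, w). ennreal ((wnorm K (linear_estimator \<Omega> \<Sigma> (T \<xi>, T \<xi> *v \<theta> + w) - \<theta>))\<^sup>2))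
      \<in> borel_measurable (P \<Otimes>\<^sub>M borel)"
    unfolding case_prod_beta by measurable
  have "risk T P K (linear_estimator \<Omega> \<Sigma>) \<theta> \<nu> = (\<integral>\<^sup>+\<xi>. \<integral>\<^sup>+w.
      ennreal ((wnorm K (linear_estimator \<Omega> \<Sigma> (T \<xi>, T \<xi> *v \<theta> + w) - \<theta>))\<^sup>2) \<partial>\<nu> \<xi> \<partial>P)"
    unfolding risk_def using nn_integral_joint_law[OF \<nu>m meas] by simp
  also have "\<dots> \<le> (\<integral>\<^sup>+\<xi>. ennreal (\<Sum>i\<in>UNIV.
      lin_risk \<Sigma> (T \<xi>) (outer \<theta>) (gain \<Omega> \<Sigma> (T \<xi>) (b i)) (b i)) \<partial>P)"
  proof (rule nn_integral_mono_AE)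
    have "AE \<xi> in P. integrable (\<nu> \<xi>) (\<lambda>w. w) \<and> (\<integral>w. w \<partial>\<nu> \<xi>) = 0 \<and>
        (\<forall>u. (\<integral>\<^sup>+w. ennreal ((u \<bullet> w)\<^sup>2) \<partial>\<nu> \<xi>) \<le> ennreal (u \<bullet> (\<Sigma> *v u)))"
      using \<nu> by (simp add: noise_class_def)
    then show "AE \<xi> in P. (\<integral>\<^sup>+w.
          ennreal ((wnorm K (linear_estimator \<Omega> \<Sigma> (T \<xi>, T \<xi> *v \<theta> + w) - \<theta>))\<^sup>2) \<partial>\<nu> \<xi>)
        \<le> ennreal (\<Sum>i\<in>UNIV. lin_risk \<Sigma> (T \<xi>) (outer \<theta>) (gain \<Omega> \<Sigma> (T \<xi>) (b i)) (b i))"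
    proof (rule AE_mp, intro AE_I2 impI)
      fix \<xi> assume \<xi>: "\<xi> \<in> space P"
      assume H: "integrable (\<nu> \<xi>) (\<lambda>w. w) \<and> (\<integral>w. w \<partial>\<nu> \<xi>) = 0 \<and>
        (\<forall>u. (\<integral>\<^sup>+w. ennreal ((u \<bullet> w)\<^sup>2) \<partial>\<nu> \<xi>) \<le> ennreal (u \<bullet> (\<Sigma> *v u)))"
      have prob: "prob_space (\<nu> \<xi>)" and sets [measurable_cong]: "sets (\<nu> \<xi>) = sets borel"
        using measurable_space[OF \<nu>m \<xi>] by (simp_all add: space_prob_algebra)
      define g where "g i = gain \<Omega> \<Sigma> (T \<xi>) (b i)" for i
      define c where "c i = \<theta> \<bullet> (g i v* T \<xi> - b i)" for i
      have "(\<integral>\<^sup>+w. ennreal ((wnorm K (linear_estimator \<Omega> \<Sigma> (T \<xi>, T \<xi> *v \<theta> + w) - \<theta>))\<^sup>2) \<partial>\<nu> \<xi>)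
          = (\<integral>\<^sup>+w. (\<Sum>i\<in>UNIV. ennreal ((c i + g i \<bullet> w)\<^sup>2)) \<partial>\<nu> \<xi>)"
        by (simp add: wnorm_error_linear_estimator[OF \<Omega> \<Sigma> K] c_def g_def b_def)
      also have "\<dots> = (\<Sum>i\<in>UNIV. \<integral>\<^sup>+w. ennreal ((c i + g i \<bullet> w)\<^sup>2) \<partial>\<nu> \<xi>)"
        by (intro nn_integral_sum) measurable
      also have "\<dots> \<le> (\<Sum>i\<in>UNIV. ennreal ((c i)\<^sup>2 + quad \<Sigma> (g i)))"
        using H by (intro sum_mono second_moment_shifted_le[OF prob sets] pos_semidef_quad
            pos_def_imp_pos_semidef \<Sigma>) (auto simp: quad_def)
      also have "\<dots> = ennreal (\<Sum>i\<in>UNIV. (c i)\<^sup>2 + quad \<Sigma> (g i))"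
        using pos_semidef_quad[OF pos_def_imp_pos_semidef[OF \<Sigma>]] by (intro sum_ennreal) auto
      finally show "(\<integral>\<^sup>+w.
          ennreal ((wnorm K (linear_estimator \<Omega> \<Sigma> (T \<xi>, T \<xi> *v \<theta> + w) - \<theta>))\<^sup>2) \<partial>\<nu> \<xi>)
        \<le> ennreal (\<Sum>i\<in>UNIV. lin_risk \<Sigma> (T \<xi>) (outer \<theta>) (gain \<Omega> \<Sigma> (T \<xi>) (b i)) (b i))"
        by (simp add: lin_risk_def quad_outer c_def g_def)
    qed
  qed
  finally show ?thesis by (simp add: mean_risk_def b_def)
qed

section \<open>Near-maximisers of the Bayes risk\<close>

lemma sum_lin_risk_nonneg:
  assumes "pos_semidef M" "pos_def \<Sigma>"
  shows "0 \<le> (\<Sum>i\<in>I. lin_risk \<Sigma> T M (a i) (b i))"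
  using assms by (auto intro!: sum_nonneg lin_risk_nonneg intro: pos_def_imp_pos_semidef)

lemma mean_risk_self:
  assumes "pos_def \<Omega>" "pos_def \<Sigma>" "transpose B = B"
  shows "mean_risk \<Sigma> T P B \<Omega> \<Omega> = (\<integral>\<^sup>+\<xi>. ennreal (trace (B **
      matrix_inv (matrix_inv \<Omega> + transpose (T \<xi>) ** matrix_inv \<Sigma> ** T \<xi>) ** B)) \<partial>P)"
  by (simp add: mean_risk_def trace_symmetric_sandwich assms lin_risk_gain)

lemma mean_risk_self_le:
  assumes "pos_semidef \<Omega>" "pos_semidef \<Omega>'" "pos_def \<Sigma>"
  shows "mean_risk \<Sigma> T P B \<Omega> \<Omega> \<le> mean_risk \<Sigma> T P B \<Omega> \<Omega>'"
  unfolding mean_risk_def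
  by (intro nn_integral_mono ennreal_leI sum_mono lin_risk_gain_le assms)

lemma mean_risk_mixture:
  assumes T: "T \<in> borel_measurable P" and \<Sigma>: "pos_def \<Sigma>"
    and M: "pos_semidef M" and M': "pos_semidef M'" and \<Omega>: "pos_semidef \<Omega>"
    and t: "0 \<le> t" "t \<le> 1"
  shows "mean_risk \<Sigma> T P B ((1 - t) *\<^sub>R M + t *\<^sub>R M') \<Omega>
    = ennreal (1 - t) * mean_risk \<Sigma> T P B M \<Omega> + ennreal t * mean_risk \<Sigma> T P B M' \<Omega>"
proof -
  define s where "s M \<xi> = (\<Sum>i\<in>UNIV. lin_risk \<Sigma> (T \<xi>) M
    (gain \<Omega> \<Sigma> (T \<xi>) (B *v axis i 1)) (B *v axis i 1))" for M \<xi>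
  have [measurable]: "(\<lambda>\<xi>. ennreal (s M \<xi>)) \<in> borel_measurable P" for M
    unfolding s_def by (rule sum_lin_risk_measurable[OF T \<Omega> \<Sigma>])
  have nn: "0 \<le> s M \<xi>" "0 \<le> s M' \<xi>" for \<xi>
    unfolding s_def by (intro sum_lin_risk_nonneg M M' \<Sigma>)+
  have "ennreal (s ((1 - t) *\<^sub>R M + t *\<^sub>R M') \<xi>)
      = ennreal (1 - t) * ennreal (s M \<xi>) + ennreal t * ennreal (s M' \<xi>)" for \<xi>
  proof -
    have "s ((1 - t) *\<^sub>R M + t *\<^sub>R M') \<xi> = (1 - t) * s M \<xi> + t * s M' \<xi>"
      by (simp add: s_def lin_risk_mixture sum.distrib sum_distrib_left)
    then show ?thesis using t nn[of \<xi>] by (simp add: ennreal_mult)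
  qed
  then have "(\<integral>\<^sup>+\<xi>. ennreal (s ((1 - t) *\<^sub>R M + t *\<^sub>R M') \<xi>) \<partial>P)
      = ennreal (1 - t) * (\<integral>\<^sup>+\<xi>. ennreal (s M \<xi>) \<partial>P) + ennreal t * (\<integral>\<^sup>+\<xi>. ennreal (s M' \<xi>) \<partial>P)"
    by (simp add: nn_integral_add nn_integral_cmult)
  then show ?thesis by (simp add: mean_risk_def s_def)
qed

text \<open>The first-order condition for a maximiser, in a form without derivatives. Let \<open>R\<close> be the mean
  risk. It is affine in its first argument and, for fixed first argument, minimal on the diagonal;
  hence
  \<open>(1 - t) R \<Omega> \<Omega> + t R M \<Omega>' \<le> (1 - t) R \<Omega> \<Omega>' + t R M \<Omega>' = R \<Omega>' \<Omega>' \<le> c \<le> R \<Omega> \<Omega> + t\<^sup>2\<close>.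
  Cancelling the first term and dividing by \<open>t\<close> gives the claim. An optimality gap of \<open>t\<^sup>2\<close> costs
  only \<open>t\<close>, so it disappears along with the step size.\<close>

lemma mean_risk_near_maximiser:
  assumes T: "T \<in> borel_measurable P" and \<Sigma>: "pos_def \<Sigma>"
    and M: "pos_semidef M" and \<Omega>: "pos_semidef \<Omega>" and t: "0 < t" "t < 1"
  defines "\<Omega>' \<equiv> (1 - t) *\<^sub>R \<Omega> + t *\<^sub>R M"
  assumes near: "c \<le> mean_risk \<Sigma> T P B \<Omega> \<Omega> + ennreal (t\<^sup>2)"
    and le: "mean_risk \<Sigma> T P B \<Omega> \<Omega> \<le> c" and le': "mean_risk \<Sigma> T P B \<Omega>' \<Omega>' \<le> c"
    and fin: "c \<noteq> \<infinity>"
  shows "mean_risk \<Sigma> T P B M \<Omega>' \<le> c + ennreal t"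
proof -
  let ?R = "mean_risk \<Sigma> T P B"
  have \<Omega>': "pos_semidef \<Omega>'"
    using pos_semidef_scaleR[OF _ \<Omega>, of "1 - t"] pos_semidef_scaleR[OF _ M, of t] t
    by (auto simp: \<Omega>'_def pos_semidef_def transpose_add quad_add)
  have "?R \<Omega> \<Omega> < \<infinity>" using le fin by (metis infinity_ennreal_def order.strict_trans1 top.not_eq_extremum)
  then have fin': "ennreal (1 - t) * ?R \<Omega> \<Omega> \<noteq> \<top>"
    by (simp add: ennreal_mult_eq_top_iff)
  have split: "?R \<Omega> \<Omega> = ennreal (1 - t) * ?R \<Omega> \<Omega> + ennreal t * ?R \<Omega> \<Omega>"
    using t by (simp flip: distrib_right ennreal_plus)
  have "?R \<Omega> \<Omega> + ennreal (t\<^sup>2)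
      = ennreal (1 - t) * ?R \<Omega> \<Omega> + (ennreal t * ?R \<Omega> \<Omega> + ennreal (t\<^sup>2))"
    by (subst split) (rule add.assoc)
  then have split2: "?R \<Omega> \<Omega> + ennreal (t\<^sup>2)
      = ennreal (1 - t) * ?R \<Omega> \<Omega> + ennreal t * (?R \<Omega> \<Omega> + ennreal t)"
    using t by (simp add: distrib_left ennreal_mult power2_eq_square)
  have "ennreal (1 - t) * ?R \<Omega> \<Omega> + ennreal t * ?R M \<Omega>'
      \<le> ennreal (1 - t) * ?R \<Omega> \<Omega>' + ennreal t * ?R M \<Omega>'"
    by (intro add_right_mono mult_left_mono mean_risk_self_le \<Omega> \<Omega>' \<Sigma>) simp
  also have "\<dots> = ?R \<Omega>' \<Omega>'"
    using mean_risk_mixture[OF T \<Sigma> \<Omega> M \<Omega>', of t B] t by (simp add: \<Omega>'_def)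
  also have "\<dots> \<le> ?R \<Omega> \<Omega> + ennreal (t\<^sup>2)" using le' near by (rule order_trans)
  also note split2
  finally have "ennreal t * ?R M \<Omega>' \<le> ennreal t * (?R \<Omega> \<Omega> + ennreal t)"
    using fin' by (simp add: ennreal_add_left_cancel_le)
  then have "?R M \<Omega>' \<le> ?R \<Omega> \<Omega> + ennreal t"
    using t by (subst (asm) ennreal_mult_le_mult_iff) auto
  also have "\<dots> \<le> c + ennreal t" using le by (rule add_right_mono)
  finally show ?thesis .
qed

text \<open>The integrand is continuous in \<open>\<Omega>\<close> for each \<open>T\<close>, also at singular limits; Fatou's lemma turns
  this into lower semicontinuity of the risk.\<close>

lemma mean_risk_le_liminf:
  assumes T: "T \<in> borel_measurable P" and \<Sigma>: "pos_def \<Sigma>"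
    and X: "\<And>k. pos_semidef (X k)" and \<Omega>: "pos_semidef \<Omega>" and lim: "X \<longlonglongrightarrow> \<Omega>"
  shows "mean_risk \<Sigma> T P B M \<Omega> \<le> liminf (\<lambda>k. mean_risk \<Sigma> T P B M (X k))"
proof -
  define s where "s \<Omega> \<xi> = (\<Sum>i\<in>UNIV. lin_risk \<Sigma> (T \<xi>) M
    (gain \<Omega> \<Sigma> (T \<xi>) (B *v axis i 1)) (B *v axis i 1))" for \<Omega> \<xi>
  have "(\<lambda>k. s (X k) \<xi>) \<longlonglongrightarrow> s \<Omega> \<xi>" for \<xi>
    unfolding s_def
    by (intro tendsto_sum tendsto_lin_risk tendsto_gain tendsto_const lim \<Omega> \<Sigma>)
  then have "ennreal (s \<Omega> \<xi>) = liminf (\<lambda>k. ennreal (s (X k) \<xi>))" for \<xi>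
    by (intro lim_imp_Liminf[symmetric] tendsto_ennrealI) auto
  then have "(\<integral>\<^sup>+\<xi>. ennreal (s \<Omega> \<xi>) \<partial>P) = (\<integral>\<^sup>+\<xi>. liminf (\<lambda>k. ennreal (s (X k) \<xi>)) \<partial>P)"
    by simp
  also have "\<dots> \<le> liminf (\<lambda>k. \<integral>\<^sup>+\<xi>. ennreal (s (X k) \<xi>) \<partial>P)"
    unfolding s_def by (intro nn_integral_liminf sum_lin_risk_measurable T X \<Sigma>)
  finally show ?thesis by (simp add: mean_risk_def s_def)
qed

section \<open>The admissible covariances\<close>

text \<open>The constraint set of \<open>\<Phi>\<close>. It is not closed: maximising sequences may converge to a singular
  matrix.\<close>
definition admissible :: "real \<Rightarrow> real^'d^'d \<Rightarrow> (real^'d^'d) set" where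
  "admissible \<rho> Kc = {\<Omega>. pos_def \<Omega> \<and>
     trace (matrix_inv (mat_sqrt Kc) ** \<Omega> ** matrix_inv (mat_sqrt Kc)) \<le> \<rho>\<^sup>2}"

lemma transpose_pos_def: "pos_def A \<Longrightarrow> transpose A = A"
  by (simp add: pos_def_def)

lemma trace_outer_sandwich:
  assumes "pos_def K"
  shows "trace (matrix_inv (mat_sqrt K) ** outer \<theta> ** matrix_inv (mat_sqrt K)) = (wnorm (matrix_inv K) \<theta>)\<^sup>2"
proof -
  let ?G = "mat_sqrt K" and ?J = "matrix_inv (mat_sqrt K)"
  have G: "pos_def ?G" "?G ** ?G = K" using mat_sqrt[OF assms] by auto
  have symJ: "transpose ?J = ?J" by (intro transpose_pos_def pos_def_matrix_inv G)
  note GJ = matrix_inv_cancel[OF pos_def_invertible[OF G(1)]]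
  have "K ** (?J ** ?J) = ?G ** (?G ** ?J) ** ?J" by (simp add: G(2) matrix_mul_assoc)
  also have "\<dots> = mat 1" by (simp add: GJ)
  finally have inv: "matrix_inv K = ?J ** ?J" by (rule matrix_inv_unique)
  have "trace (?J ** outer \<theta> ** ?J) = quad (?J ** ?J) \<theta>"
    by (simp add: trace_symmetric_sandwich[OF symJ] quad_outer quad_square_sum[OF symJ] inner_commute)
  also have "\<dots> = (wnorm (matrix_inv K) \<theta>)\<^sup>2"
    using pos_semidef_quad[OF pos_def_imp_pos_semidef[OF pos_def_matrix_inv[OF assms]], of \<theta>]
    by (simp add: wnorm_def quad_def inv)
  finally show ?thesis .
qed

text \<open>The trace constraint bounds the mean of \<open>\<theta>\<^sup>T K\<^sup>-\<^sup>1 \<theta>\<close> for a random \<open>\<theta>\<close> with second moments \<open>\<Omega>\<close>.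
  A parameter in the ellipsoid thus satisfies it through \<open>\<theta> \<theta>\<^sup>T\<close>, and the share of \<open>\<Omega>\<close> keeps the
  mixture definite.\<close>

lemma admissible_mixture:
  assumes K: "pos_def K" and \<Omega>: "\<Omega> \<in> admissible \<rho> K" and \<theta>: "\<theta> \<in> param_set \<rho> K"
    and t: "0 \<le> t" "t < 1"
  shows "(1 - t) *\<^sub>R \<Omega> + t *\<^sub>R outer \<theta> \<in> admissible \<rho> K"
proof -
  let ?J = "matrix_inv (mat_sqrt K)"
  have symJ: "transpose ?J = ?J"
    by (intro transpose_pos_def pos_def_matrix_inv mat_sqrt K)
  have "0 \<le> wnorm (matrix_inv K) \<theta>"
    using pos_semidef_quad[OF pos_def_imp_pos_semidef[OF pos_def_matrix_inv[OF K]], of \<theta>]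
    by (simp add: wnorm_def quad_def)
  then have tr\<theta>: "trace (?J ** outer \<theta> ** ?J) \<le> \<rho>\<^sup>2"
    using \<theta> by (simp add: trace_outer_sandwich[OF K] param_set_def power_mono)
  have "trace (?J ** ((1 - t) *\<^sub>R \<Omega> + t *\<^sub>R outer \<theta>) ** ?J)
      = (1 - t) * trace (?J ** \<Omega> ** ?J) + t * trace (?J ** outer \<theta> ** ?J)"
    by (simp only: trace_symmetric_sandwich[OF symJ] quad_add quad_scaleR sum.distrib sum_distrib_left)
  also have "\<dots> \<le> (1 - t) * \<rho>\<^sup>2 + t * \<rho>\<^sup>2"
    using t tr\<theta> \<Omega> by (intro add_mono mult_left_mono) (auto simp: admissible_def)
  also have "\<dots> = \<rho>\<^sup>2" by (simp add: algebra_simps)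
  finally have "trace (?J ** ((1 - t) *\<^sub>R \<Omega> + t *\<^sub>R outer \<theta>) ** ?J) \<le> \<rho>\<^sup>2" .
  moreover have "pos_def (t *\<^sub>R outer \<theta> + (1 - t) *\<^sub>R \<Omega>)"
    using t \<Omega> by (intro pos_def_add_pos_semidef pos_semidef_scaleR pos_semidef_outer pos_def_scaleR)
      (auto simp: admissible_def)
  ultimately show ?thesis by (simp add: admissible_def add.commute)
qed

lemma admissible_nonempty:
  assumes "pos_def K" "\<rho> > 0"
  shows "admissible \<rho> K \<noteq> {}"
proof -
  let ?J = "matrix_inv (mat_sqrt K)"
  have symJ: "transpose ?J = ?J"
    by (intro transpose_pos_def pos_def_matrix_inv mat_sqrt assms)
  define q where "q = trace (?J ** mat 1 ** ?J)"
  have q: "0 \<le> q"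
    unfolding q_def trace_symmetric_sandwich[OF symJ]
    by (intro sum_nonneg pos_semidef_quad pos_def_imp_pos_semidef pos_def_mat_1)
  let ?c = "\<rho>\<^sup>2 / (1 + q)"
  have "trace (?J ** (?c *\<^sub>R mat 1) ** ?J) = ?c * q"
    by (simp only: q_def trace_symmetric_sandwich[OF symJ] quad_scaleR sum_distrib_left)
  also have "\<dots> \<le> \<rho>\<^sup>2" using q by (simp add: field_simps)
  finally have "?c *\<^sub>R mat 1 \<in> admissible \<rho> K"
    using q assms by (simp add: admissible_def pos_def_scaleR pos_def_mat_1)
  then show ?thesis by blast
qed

text \<open>With \<open>J\<close> the inverse square root of \<open>K\<close>, the trace bounds \<open>J \<Omega> J\<close>. Compactness applies to
  these matrices, and multiplying with \<open>J\<^sup>-\<^sup>1\<close> on both sides transports the convergence back.\<close>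

lemma admissible_convergent_subseq:
  assumes K: "pos_def K" and X: "\<And>k. X k \<in> admissible \<rho> K"
  obtains \<Omega> r where "pos_semidef \<Omega>" "strict_mono (r :: nat \<Rightarrow> nat)" "(\<lambda>k. X (r k)) \<longlonglongrightarrow> \<Omega>"
proof -
  let ?G = "mat_sqrt K" and ?J = "matrix_inv (mat_sqrt K)"
  have G: "pos_def ?G" by (rule mat_sqrt[OF K])
  have symJ: "transpose ?J = ?J" by (intro transpose_pos_def pos_def_matrix_inv G)
  note GJ = matrix_inv_cancel[OF pos_def_invertible[OF G]]
  have pdX: "pos_semidef (X k)" for k
    using X[of k] by (simp add: admissible_def pos_def_imp_pos_semidef)
  define N where "N k = ?J ** X k ** ?J" for k
  have XN: "X k = ?G ** N k ** ?G" for k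
  proof -
    have "?G ** N k ** ?G = (?G ** ?J) ** X k ** (?J ** ?G)"
      by (simp only: N_def matrix_mul_assoc)
    then show ?thesis by (simp add: GJ)
  qed
  have "\<bar>N k $ i $ j\<bar> \<le> \<rho>\<^sup>2" for k i j
  proof -
    have "pos_semidef (N k)"
      using pos_semidef_congruence[OF pdX, of ?J k] by (simp add: N_def symJ)
    then have "\<bar>N k $ i $ j\<bar> \<le> trace (N k)" by (rule pos_semidef_entry_le_trace)
    also have "\<dots> \<le> \<rho>\<^sup>2" using X[of k] by (simp add: admissible_def N_def)
    finally show ?thesis .
  qed
  then have "bounded (range N)"
    unfolding bounded_iff by (blast intro: norm_matrix_le_entries)
  then obtain l and r :: "nat \<Rightarrow> nat" where r: "strict_mono r" and l: "(N \<circ> r) \<longlonglongrightarrow> l"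
    using bounded_imp_convergent_subsequence by blast
  have lim: "(\<lambda>k. X (r k)) \<longlonglongrightarrow> ?G ** l ** ?G"
    unfolding XN using l by (intro tendsto_intros) (simp add: o_def)
  have "(\<lambda>k. transpose (X (r k))) \<longlonglongrightarrow> transpose (?G ** l ** ?G)" by (intro tendsto_intros lim)
  then have "(\<lambda>k. X (r k)) \<longlonglongrightarrow> transpose (?G ** l ** ?G)"
    using pdX by (simp add: pos_semidef_def)
  then have "transpose (?G ** l ** ?G) = ?G ** l ** ?G" using lim LIMSEQ_unique by blast
  moreover have "0 \<le> quad (?G ** l ** ?G) x" for x
    using pos_semidef_quad[OF pdX]
    by (intro LIMSEQ_le_const[OF tendsto_quad[OF lim tendsto_const]]) auto
  ultimately have "pos_semidef (?G ** l ** ?G)" by (simp add: pos_semidef_def)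
  then show thesis using r lim that by blast
qed

section \<open>The minimax bound\<close>

lemma functional_Phi_mean_risk:
  assumes "pos_def \<Sigma>" "pos_def Ke"
  shows "functional_Phi T P \<Sigma> \<rho> Ke Kc
    = (SUP \<Omega>\<in>admissible \<rho> Kc. mean_risk \<Sigma> T P (mat_sqrt Ke) \<Omega> \<Omega>)"
  unfolding functional_Phi_def admissible_def
  by (intro SUP_cong refl)
    (simp add: mean_risk_self[OF _ assms(1) transpose_pos_def[OF mat_sqrt(1)[OF assms(2)]]])

text \<open>A limit \<open>\<Omega>\<close> of near-maximisers works for every \<open>\<theta>\<close> simultaneously. For each \<open>\<theta>\<close> the
  near-maximisers are tilted slightly towards \<open>\<theta> \<theta>\<^sup>T\<close>; the first-order condition bounds the risk at
  \<open>\<theta>\<close> of the tilted estimators, and since the tilt vanishes, they all have the same limit, the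
  estimator tuned to \<open>\<Omega>\<close>.\<close>

lemma least_favourable_covariance:
  assumes T: "T \<in> borel_measurable P" and \<rho>: "\<rho> > 0"
    and \<Sigma>: "pos_def \<Sigma>" and Ke: "pos_def Ke" and Kc: "pos_def Kc"
    and fin: "functional_Phi T P \<Sigma> \<rho> Ke Kc \<noteq> \<infinity>"
  obtains \<Omega> where "pos_semidef \<Omega>"
    "\<And>\<theta>. \<theta> \<in> param_set \<rho> Kc \<Longrightarrow>
      mean_risk \<Sigma> T P (mat_sqrt Ke) (outer \<theta>) \<Omega> \<le> functional_Phi T P \<Sigma> \<rho> Ke Kc"
proof -
  define \<Phi> where "\<Phi> = functional_Phi T P \<Sigma> \<rho> Ke Kc"
  let ?R = "mean_risk \<Sigma> T P (mat_sqrt Ke)" and ?F = "admissible \<rho> Kc"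
  have \<Phi>: "\<Phi> = (SUP \<Omega>\<in>?F. ?R \<Omega> \<Omega>)" unfolding \<Phi>_def by (rule functional_Phi_mean_risk[OF \<Sigma> Ke])
  have le\<Phi>: "?R \<Omega> \<Omega> \<le> \<Phi>" if "\<Omega> \<in> ?F" for \<Omega> unfolding \<Phi> using that by (rule SUP_upper)
  \<comment> \<open>Step sizes; the \<open>k\<close>-th near-maximiser is chosen with optimality gap below \<open>(t k)\<^sup>2\<close>.\<close>
  define t :: "nat \<Rightarrow> real" where "t k = inverse (real (Suc (Suc k)))" for k
  have t: "0 < t k" "t k < 1" for k by (auto simp: t_def inverse_less_1_iff)
  have t0: "t \<longlonglongrightarrow> 0" unfolding t_def by (rule LIMSEQ_Suc[OF LIMSEQ_inverse_real_of_nat])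
  have ex: "\<exists>\<Omega>\<in>?F. \<Phi> < ?R \<Omega> \<Omega> + ennreal ((t k)\<^sup>2)" for k
    using t(1)[of k] fin
    by (intro SUP_approx_ennreal[OF _ admissible_nonempty[OF Kc \<rho>] \<Phi>]) (simp_all add: \<Phi>_def)
  obtain X where "\<forall>k\<in>UNIV. X k \<in> ?F \<and> \<Phi> < ?R (X k) (X k) + ennreal ((t k)\<^sup>2)"
    using bchoice[of UNIV "\<lambda>k \<Omega>. \<Omega> \<in> ?F \<and> \<Phi> < ?R \<Omega> \<Omega> + ennreal ((t k)\<^sup>2)"] ex by blast
  then have X: "\<And>k. X k \<in> ?F" "\<And>k. \<Phi> < ?R (X k) (X k) + ennreal ((t k)\<^sup>2)"
    by simp_all
  obtain \<Omega> r where \<Omega>: "pos_semidef \<Omega>" and r: "strict_mono r" and lim: "(\<lambda>k. X (r k)) \<longlonglongrightarrow> \<Omega>"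
    by (rule admissible_convergent_subseq[OF Kc X(1)])
  have tr0: "(\<lambda>k. t (r k)) \<longlonglongrightarrow> 0" using LIMSEQ_subseq_LIMSEQ[OF t0 r] by (simp add: o_def)
  show thesis
  proof (rule that[OF \<Omega>])
    fix \<theta> assume \<theta>: "\<theta> \<in> param_set \<rho> Kc"
    define Y where "Y k = (1 - t (r k)) *\<^sub>R X (r k) + t (r k) *\<^sub>R outer \<theta>" for k
    have YF: "Y k \<in> ?F" for k
      unfolding Y_def using t by (intro admissible_mixture Kc X \<theta>) (auto intro: less_imp_le)
    have psd: "pos_semidef A" if "A \<in> ?F" for A
      using that by (simp add: admissible_def pos_def_imp_pos_semidef)
    have Y: "?R (outer \<theta>) (Y k) \<le> \<Phi> + ennreal (t (r k))" for k
      unfolding Y_def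
    proof (rule mean_risk_near_maximiser[OF T \<Sigma> pos_semidef_outer psd[OF X(1)] t])
      show "?R ((1 - t (r k)) *\<^sub>R X (r k) + t (r k) *\<^sub>R outer \<theta>)
          ((1 - t (r k)) *\<^sub>R X (r k) + t (r k) *\<^sub>R outer \<theta>) \<le> \<Phi>"
        using le\<Phi>[OF YF[of k]] by (simp add: Y_def)
    qed (use X(2)[of "r k"] le\<Phi>[OF X(1)] fin in \<open>auto simp: \<Phi>_def less_imp_le\<close>)
    have "Y \<longlonglongrightarrow> (1 - 0) *\<^sub>R \<Omega> + 0 *\<^sub>R outer \<theta>"
      unfolding Y_def by (intro tendsto_intros lim tr0)
    then have "?R (outer \<theta>) \<Omega> \<le> liminf (\<lambda>k. ?R (outer \<theta>) (Y k))"
      by (intro mean_risk_le_liminf[OF T \<Sigma> psd[OF YF] \<Omega>]) simp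
    also have "\<dots> \<le> liminf (\<lambda>k. \<Phi> + ennreal (t (r k)))"
      by (intro Liminf_mono always_eventually allI Y)
    also have "\<dots> = \<Phi>"
    proof (rule lim_imp_Liminf)
      have "(\<lambda>k. \<Phi> + ennreal (t (r k))) \<longlonglongrightarrow> \<Phi> + ennreal 0" by (intro tendsto_intros tr0)
      then show "(\<lambda>k. \<Phi> + ennreal (t (r k))) \<longlonglongrightarrow> \<Phi>" by simp
    qed simp
    finally show "?R (outer \<theta>) \<Omega> \<le> functional_Phi T P \<Sigma> \<rho> Ke Kc" by (simp add: \<Phi>_def)
  qed
qed

theorem theorem1:
  fixes P :: "'x measure"
    and T :: "'x \<Rightarrow> real^'d^'n"
    and \<Sigma>w :: "real^'n^'n"
    and Ke Kc :: "real^'d^'d"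
    and \<rho> :: real
  assumes "prob_space P"
    and "T \<in> borel_measurable P"
    and "\<rho> > 0"
    and "pos_def \<Sigma>w"
    and "pos_def Ke"
    and "pos_def Kc"
  shows "minimax_risk T P \<Sigma>w \<rho> Ke Kc \<le> functional_Phi T P \<Sigma>w \<rho> Ke Kc"
proof (cases "functional_Phi T P \<Sigma>w \<rho> Ke Kc = \<infinity>")
  case False
  then obtain \<Omega> where \<Omega>: "pos_semidef \<Omega>"
    and le: "\<And>\<theta>. \<theta> \<in> param_set \<rho> Kc \<Longrightarrow>
      mean_risk \<Sigma>w T P (mat_sqrt Ke) (outer \<theta>) \<Omega> \<le> functional_Phi T P \<Sigma>w \<rho> Ke Kc"
    using least_favourable_covariance[OF assms(2-6)] by blast
  have "minimax_risk T P \<Sigma>w \<rho> Ke Kc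
      \<le> (SUP (\<theta>, \<nu>) \<in> param_set \<rho> Kc \<times> noise_class P \<Sigma>w. risk T P Ke (linear_estimator \<Omega> \<Sigma>w) \<theta> \<nu>)"
    unfolding minimax_risk_def
    by (rule INF_lower) (rule linear_estimator_measurable[OF \<Omega> assms(4)])
  also have "\<dots> \<le> functional_Phi T P \<Sigma>w \<rho> Ke Kc"
  proof (rule SUP_least, clarify)
    fix \<theta> \<nu> assume \<theta>: "\<theta> \<in> param_set \<rho> Kc" and \<nu>: "\<nu> \<in> noise_class P \<Sigma>w"
    have "risk T P Ke (linear_estimator \<Omega> \<Sigma>w) \<theta> \<nu> \<le> mean_risk \<Sigma>w T P (mat_sqrt Ke) (outer \<theta>) \<Omega>"
      by (rule risk_linear_estimator_le[OF assms(2) \<Omega> assms(4,5) \<nu>])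
    also note le[OF \<theta>]
    finally show "risk T P Ke (linear_estimator \<Omega> \<Sigma>w) \<theta> \<nu> \<le> functional_Phi T P \<Sigma>w \<rho> Ke Kc" .
  qed
  finally show ?thesis .
qed simp

end
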